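(* Let $A,B,C,D\in\mathbb{C}^{n\times n}$ and $M=\begin{pmatrix} A & B \\ C & D \end{pmatrix}$. Suppose that the group inverses $A^{\#}$ and $D^{\#}$ exist, and let $P=pppt(M,A)_{\#}$ and $Q=cpppt(M,D)_{\#}$. (i) If $R(B)\subseteq R(A)$ and $R(C^* )\subseteq R(A^* )$, then for all $x^1,x^2,y^1,y^2\in\mathbb{C}^n$: $$M\begin{pmatrix} x^1 \\ x^2 \end{pmatrix}=\begin{pmatrix} AA^{\#}y^1 \\ y^2 \end{pmatrix}\quad\text{if and only if}\quad P\begin{pmatrix} y^1 \\ x^2 \end{pmatrix}=\begin{pmatrix} A^{\#}Ax^1 \\ y^2 \end{pmatrix}.$$ (ii) If $R(C)\subseteq R(D)$ and $R(B^* )\subseteq R(D^* )$, then for all $x^1,x^2,y^1,y^2\in\mathbb{C}^n$: $$M\begin{pmatrix} x^1 \\ x^2 \end{pmatrix}=\begin{pmatrix} y^1 \\ DD^{\#}y^2 \end{pmatrix}\quad\text{if and only if}\quad Q\begin{pmatrix} x^1 \\ y^2 \end{pmatrix}=\begin{pmatrix} y^1 \\ D^{\#}Dx^2 \end{pmatrix}.$$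
   Context: For a square complex matrix $T$, the group inverse $T^{\#}$ (if it exists) is the unique matrix $X$ with $TXT=T$, $XTX=X$ and $TX=XT$. $R(T)$ denotes the range (column space) of $T$ and $T^*$ the conjugate transpose of $T$. For a block matrix $M=\begin{pmatrix} A & B \\ C & D \end{pmatrix}$ with $n\times n$ complex blocks such that $A^{\#}$ exists, the pseudo principal pivot transform of $M$ relative to $A$ is $$pppt(M,A)_{\#}=\begin{pmatrix} A^{\#} & -A^{\#}B \\ CA^{\#} & D-CA^{\#}B \end{pmatrix}.$$ If $D^{\#}$ exists, the complementary pseudo principal pivot transform of $M$ relative to $D$ is $$cpppt(M,D)_{\#}=\begin{pmatrix} A-BD^{\#}C & BD^{\#} \\ -D^{\#}C & D^{\#} \end{pmatrix}.$$ Superscripts $1,2$ on $x,y$ are indices of block components, not powers. *)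

theory Defs
  imports
    "Jordan_Normal_Form.Schur_Decomposition"
    "Jordan_Normal_Form.VS_Connect"
begin

definition is_group_inverse :: "complex mat \<Rightarrow> complex mat \<Rightarrow> bool" where
  "is_group_inverse T X \<longleftrightarrow>
     square_mat T \<and> X \<in> carrier_mat (dim_row T) (dim_row T) \<and>
     T * X * T = T \<and> X * T * X = X \<and> T * X = X * T"

definition has_group_inverse :: "complex mat \<Rightarrow> bool" where
  "has_group_inverse T \<longleftrightarrow> (\<exists>X. is_group_inverse T X)"

(* Meaningful only under has_group_inverse T; unspecified otherwise. *)
definition group_inverse :: "complex mat \<Rightarrow> complex mat"
    (\<open>(_\<^sup>#)\<close> [1000] 999) where
  "T\<^sup># = (THE X. is_group_inverse T X)"

lemma is_group_inverse_unique:
  assumes X: "is_group_inverse T X" and Y: "is_group_inverse T Y"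
  shows "X = Y"
proof -
  define n where "n = dim_row T"
  have T: "T \<in> carrier_mat n n" and cX: "X \<in> carrier_mat n n" and cY: "Y \<in> carrier_mat n n"
    using X Y by (auto simp: is_group_inverse_def n_def)
  have x: "T * X * T = T" "X * T * X = X" "T * X = X * T"
    and y: "T * Y * T = T" "Y * T * Y = Y" "T * Y = Y * T"
    using X Y by (auto simp: is_group_inverse_def)
  note assoc = assoc_mult_mat[of _ n n _ n _ n]
  have "X * T = X * (T * Y * T)" by (simp only: y(1))
  also have "\<dots> = (X * T) * (Y * T)" using T cX cY by (simp add: assoc)
  also have "\<dots> = (T * X) * (T * Y)" by (simp only: x(3) y(3))
  also have "\<dots> = (T * X * T) * Y" using T cX cY by (simp add: assoc)
  also have "\<dots> = T * Y" by (simp only: x(1))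
  finally have XT: "X * T = T * Y" .
  have "X = (X * T) * X" by (simp only: x(2))
  also have "\<dots> = (Y * T) * X" by (simp only: XT y(3))
  also have "\<dots> = Y * (T * X)" using T cX cY by (simp add: assoc)
  also have "\<dots> = Y * (T * Y)" by (simp only: x(3) XT)
  also have "\<dots> = Y * T * Y" using T cY by (simp add: assoc)
  also have "\<dots> = Y" by (rule y(2))
  finally show ?thesis .
qed

lemma is_group_inverse_group_inverse:
  "has_group_inverse T \<Longrightarrow> is_group_inverse T (T\<^sup>#)"
  unfolding has_group_inverse_def group_inverse_def
  by (metis is_group_inverse_unique theI)

(* The block matrix M is passed as its four blocks A, B, C, D. *)
definition pppt :: "complex mat \<Rightarrow> complex mat \<Rightarrow> complex mat \<Rightarrow> complex mat \<Rightarrow> complex mat" where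
  "pppt A B C D =
     four_block_mat (A\<^sup>#) (- (A\<^sup># * B)) (C * A\<^sup>#) (D - C * A\<^sup># * B)"

definition cpppt :: "complex mat \<Rightarrow> complex mat \<Rightarrow> complex mat \<Rightarrow> complex mat \<Rightarrow> complex mat" where
  "cpppt A B C D =
     four_block_mat (A - B * D\<^sup># * C) (B * D\<^sup>#) (- (D\<^sup># * C)) (D\<^sup>#)"

end

theory Submission
  imports Defs
begin

text \<open>
  The range inclusions enter only through the absorption laws \<open>A * A\<^sup># * B = B\<close> and
  \<open>C * A\<^sup># * A = C\<close>.  Given these, multiplying the first block equation of the \<open>M\<close>-system by
  \<open>A\<^sup>#\<close>, respectively that of the \<open>P\<close>-system by \<open>A\<close>, turns the one into the other; and
  substituting \<open>A\<^sup># y\<^sup>1 - A\<^sup># B x\<^sup>2 = A\<^sup># A x\<^sup>1\<close> makes the second block equations agree.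
  Part (ii) is part (i) with the two block rows and the two block columns interchanged.
\<close>

lemma mat_adjoint_carrier:
  assumes "A \<in> carrier_mat nr nc"
  shows "mat_adjoint A \<in> carrier_mat nc nr"
  using assms by (auto simp: mat_adjoint_def)

lemma index_mat_adjoint:
  assumes "A \<in> carrier_mat nr nc" "i < nc" "j < nr"
  shows "mat_adjoint A $$ (i, j) = conjugate (A $$ (j, i))"
  using assms by (auto simp: mat_adjoint_def mat_of_rows_def)

lemma mat_adjoint_mat_adjoint:
  assumes A: "A \<in> carrier_mat nr nc"
  shows "mat_adjoint (mat_adjoint A) = A"
proof -
  note A' = mat_adjoint_carrier[OF A]
  note A'' = mat_adjoint_carrier[OF A']
  show ?thesis
  proof (rule eq_matI)
    fix i j assume "i < dim_row A" "j < dim_col A"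
    hence "i < nr" "j < nc" using A by auto
    thus "mat_adjoint (mat_adjoint A) $$ (i, j) = A $$ (i, j)"
      by (simp add: index_mat_adjoint[OF A'] index_mat_adjoint[OF A])
  qed (use A A'' in auto)
qed

lemma mat_adjoint_mult:
  assumes A: "A \<in> carrier_mat nr n" and B: "B \<in> carrier_mat n nc"
  shows "mat_adjoint (A * B) = mat_adjoint B * mat_adjoint A"
proof -
  have AB: "A * B \<in> carrier_mat nr nc" using A B by simp
  note A' = mat_adjoint_carrier[OF A] and B' = mat_adjoint_carrier[OF B]
  show ?thesis
  proof (rule eq_matI)
    fix i j assume "i < dim_row (mat_adjoint B * mat_adjoint A)"
      "j < dim_col (mat_adjoint B * mat_adjoint A)"
    hence i: "i < nc" and j: "j < nr" using A' B' by auto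
    \<comment> \<open>Conjugation is multiplicative without reversing factors, so the reversal comes
      from commutativity of the scalars.\<close>
    have "(\<Sum>k<n. conjugate (A $$ (j, k) * B $$ (k, i))) =
      (\<Sum>k<n. mat_adjoint B $$ (i, k) * mat_adjoint A $$ (k, j))"
      by (rule sum.cong)
        (simp_all add: index_mat_adjoint[OF A _ j] index_mat_adjoint[OF B i]
          conjugate_dist_mul mult.commute)
    thus "mat_adjoint (A * B) $$ (i, j) = (mat_adjoint B * mat_adjoint A) $$ (i, j)"
      using A B A' B' i j
      by (simp add: index_mat_adjoint[OF AB i j] scalar_prod_def sum_conjugate lessThan_atLeast0)
  qed (use mat_adjoint_carrier[OF AB] A' B' in auto)
qed

text \<open>Since \<open>A * G * A = A\<close>, the matrix \<open>A * G\<close> fixes every vector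
  of the form \<open>A z\<close>, and by the range inclusion each column of \<open>B\<close> has
  this form.\<close>

lemma inner_inverse_absorb_left:
  fixes A B G :: "'a :: field mat"
  assumes A: "A \<in> carrier_mat n m" and G: "G \<in> carrier_mat m n" and B: "B \<in> carrier_mat n k"
    and AGA: "A * G * A = A"
    and range: "vec_space.col_space n B \<subseteq> vec_space.col_space n A"
  shows "A * G * B = B"
proof (rule mat_col_eqI)
  fix i assume "i < dim_col B"
  hence i: "i < k" using B by simp
  \<comment> \<open>Writing the column as an image of a unit vector exhibits it as a member of the
    column space, which \<open>vec_space.col_space_eq\<close> describes as the set of
    images.\<close>
  have "col B i = B *\<^sub>v unit_vec k i" using B i by (intro eq_vecI) auto
  hence "col B i \<in> vec_space.col_space n B"
    unfolding vec_space.col_space_eq[OF B] using B i by auto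
  hence "col B i \<in> vec_space.col_space n A" using range by auto
  then obtain z where z: "z \<in> carrier_vec m" "A *\<^sub>v z = col B i"
    unfolding vec_space.col_space_eq[OF A] using A by auto
  have "A * G *\<^sub>v (A *\<^sub>v z) = A *\<^sub>v z"
    using A G z(1) AGA by (metis assoc_mult_mat_vec mult_carrier_mat)
  thus "col (A * G * B) i = col B i"
    using A B G i z(2) by (simp add: col_mult2[of _ n n _ k] del: assoc_mult_mat)
qed (use A B G in simp_all)

text \<open>Taking adjoints reduces this to the left absorption law for the adjoints of
  \<open>A\<close>, \<open>G\<close> and \<open>C\<close>. Involutivity of the adjoint then brings
  the equation back.\<close>

lemma inner_inverse_absorb_right:
  fixes A C G :: "'a :: conjugatable_field mat"
  assumes A: "A \<in> carrier_mat n m" and G: "G \<in> carrier_mat m n" and C: "C \<in> carrier_mat k m"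
    and AGA: "A * G * A = A"
    and range: "vec_space.col_space m (mat_adjoint C) \<subseteq> vec_space.col_space m (mat_adjoint A)"
  shows "C * G * A = C"
proof -
  note A' = mat_adjoint_carrier[OF A] and G' = mat_adjoint_carrier[OF G]
    and C' = mat_adjoint_carrier[OF C]
  \<comment> \<open>Stated for general \<open>X\<close> because it serves twice:
    \<open>X = A\<close> shows that the adjoint of \<open>G\<close> is an inner inverse of the
    adjoint of \<open>A\<close>, and \<open>X = C\<close> translates the claim itself.\<close>
  have adj: "mat_adjoint (X * G * A) = mat_adjoint A * mat_adjoint G * mat_adjoint X"
    if X: "X \<in> carrier_mat l m" for X l
    using X A G A' G' mat_adjoint_carrier[OF X]
    by (simp add: mat_adjoint_mult[of _ l m _ m] mat_adjoint_mult[of _ m n _ m])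
  have "mat_adjoint A * mat_adjoint G * mat_adjoint C = mat_adjoint C"
    using inner_inverse_absorb_left[OF A' G' C' _ range] adj[OF A] AGA by simp
  hence "mat_adjoint (C * G * A) = mat_adjoint C" using adj[OF C] by simp
  moreover have "C * G * A \<in> carrier_mat k m" using A C G by simp
  ultimately show ?thesis using C by (metis mat_adjoint_mat_adjoint)
qed

text \<open>Accounts for the minus sign of the upper right block of the pivot transform.\<close>

lemma vec_add_eq_iff_add_uminus:
  fixes a b c :: "'a :: ab_group_add vec"
  assumes "a \<in> carrier_vec n" "b \<in> carrier_vec n" "c \<in> carrier_vec n"
  shows "a + b = c \<longleftrightarrow> c + - b = a"
  using assms by (auto simp: vec_eq_iff algebra_simps)

text \<open>Lets identities between triple products of matrices act on nested applications to a
  vector.\<close>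

lemma mult_mat_vec_mult_mat_vec:
  fixes A B C :: "'a :: semiring_0 mat"
  assumes "A \<in> carrier_mat nr n" "B \<in> carrier_mat n m" "C \<in> carrier_mat m nc"
    and "v \<in> carrier_vec nc"
  shows "A *\<^sub>v (B *\<^sub>v (C *\<^sub>v v)) = (A * B * C) *\<^sub>v v"
  using assms by (simp add: assoc_mult_mat_vec[of _ nr n _ nc] assoc_mult_mat_vec[of _ n m _ nc])

text \<open>Here \<open>G\<close> stands for \<open>A\<^sup>#\<close> or \<open>D\<^sup>#\<close>.
  Taking the absorption laws as hypotheses and working with separate blocks makes both parts of the
  theorem instances of this one equivalence.\<close>

lemma principal_pivot_iff:
  fixes A B C D G :: "'a :: field mat"
  assumes A: "A \<in> carrier_mat n n" and B: "B \<in> carrier_mat n m"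
    and C: "C \<in> carrier_mat m n" and D: "D \<in> carrier_mat m m" and G: "G \<in> carrier_mat n n"
    and AGA: "A * G * A = A" and GAG: "G * A * G = G"
    and AGB: "A * G * B = B" and CGA: "C * G * A = C"
    and x1: "x1 \<in> carrier_vec n" and x2: "x2 \<in> carrier_vec m"
    and y1: "y1 \<in> carrier_vec n" and y2: "y2 \<in> carrier_vec m"
  shows "A *\<^sub>v x1 + B *\<^sub>v x2 = (A * G) *\<^sub>v y1 \<and> C *\<^sub>v x1 + D *\<^sub>v x2 = y2 \<longleftrightarrow>
    G *\<^sub>v y1 + (- (G * B)) *\<^sub>v x2 = (G * A) *\<^sub>v x1 \<and>
    (C * G) *\<^sub>v y1 + (D - C * G * B) *\<^sub>v x2 = y2"
proof -
  have car: "A *\<^sub>v x1 \<in> carrier_vec n" "B *\<^sub>v x2 \<in> carrier_vec n" "G *\<^sub>v y1 \<in> carrier_vec n"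
    "G *\<^sub>v (A *\<^sub>v x1) \<in> carrier_vec n" "G *\<^sub>v (B *\<^sub>v x2) \<in> carrier_vec n"
    "A *\<^sub>v (G *\<^sub>v y1) \<in> carrier_vec n"
    using A B G x1 x2 y1 by auto
  have AGA': "A *\<^sub>v (G *\<^sub>v (A *\<^sub>v x1)) = A *\<^sub>v x1"
    unfolding mult_mat_vec_mult_mat_vec[OF A G A x1] AGA ..
  have GAG': "G *\<^sub>v (A *\<^sub>v (G *\<^sub>v y1)) = G *\<^sub>v y1"
    unfolding mult_mat_vec_mult_mat_vec[OF G A G y1] GAG ..
  have AGB': "A *\<^sub>v (G *\<^sub>v (B *\<^sub>v x2)) = B *\<^sub>v x2"
    unfolding mult_mat_vec_mult_mat_vec[OF A G B x2] AGB ..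
  have CGA': "C *\<^sub>v (G *\<^sub>v (A *\<^sub>v x1)) = C *\<^sub>v x1"
    unfolding mult_mat_vec_mult_mat_vec[OF C G A x1] CGA ..
  \<comment> \<open>Forwards, \<open>GAG'\<close> simplifies the right-hand side; backwards,
    \<open>AGA'\<close> and \<open>AGB'\<close> restore the two summands on the left.\<close>
  have first: "A *\<^sub>v x1 + B *\<^sub>v x2 = A *\<^sub>v (G *\<^sub>v y1) \<longleftrightarrow>
    G *\<^sub>v (A *\<^sub>v x1) + G *\<^sub>v (B *\<^sub>v x2) = G *\<^sub>v y1"
  proof
    assume "A *\<^sub>v x1 + B *\<^sub>v x2 = A *\<^sub>v (G *\<^sub>v y1)"
    hence "G *\<^sub>v (A *\<^sub>v x1 + B *\<^sub>v x2) = G *\<^sub>v y1" by (simp add: GAG')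
    thus "G *\<^sub>v (A *\<^sub>v x1) + G *\<^sub>v (B *\<^sub>v x2) = G *\<^sub>v y1"
      using car by (simp add: mult_add_distrib_mat_vec[OF G])
  next
    assume "G *\<^sub>v (A *\<^sub>v x1) + G *\<^sub>v (B *\<^sub>v x2) = G *\<^sub>v y1"
    hence "A *\<^sub>v (G *\<^sub>v (A *\<^sub>v x1) + G *\<^sub>v (B *\<^sub>v x2)) = A *\<^sub>v (G *\<^sub>v y1)" by simp
    thus "A *\<^sub>v x1 + B *\<^sub>v x2 = A *\<^sub>v (G *\<^sub>v y1)"
      using car by (simp add: mult_add_distrib_mat_vec[OF A] AGA' AGB')
  qed
  \<comment> \<open>Under the first block equation, \<open>C * G\<close> maps \<open>y1\<close> to
    \<open>C x1 + C G B x2\<close>. The last term cancels against the one subtracted in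
    \<open>D - C * G * B\<close>, so both systems have the same second left-hand side.\<close>
  have second: "C *\<^sub>v x1 + D *\<^sub>v x2 = (C * G) *\<^sub>v y1 + (D - C * G * B) *\<^sub>v x2"
    if "G *\<^sub>v (A *\<^sub>v x1) + G *\<^sub>v (B *\<^sub>v x2) = G *\<^sub>v y1"
  proof -
    have cgb: "(D - C * G * B) *\<^sub>v x2 = D *\<^sub>v x2 - C *\<^sub>v (G *\<^sub>v (B *\<^sub>v x2))"
      unfolding mult_mat_vec_mult_mat_vec[OF C G B x2]
      by (rule minus_mult_distrib_mat_vec) (use B C D G x2 in auto)
    have "(C * G) *\<^sub>v y1 = C *\<^sub>v (G *\<^sub>v (A *\<^sub>v x1) + G *\<^sub>v (B *\<^sub>v x2))"
      using C G y1 that by simp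
    also have "\<dots> = C *\<^sub>v x1 + C *\<^sub>v (G *\<^sub>v (B *\<^sub>v x2))"
      using car by (simp add: mult_add_distrib_mat_vec[OF C] CGA')
    finally show ?thesis unfolding cgb using C D x1 x2 car by (auto simp: vec_eq_iff)
  qed
  have "(- (G * B)) *\<^sub>v x2 = - (G *\<^sub>v (B *\<^sub>v x2))" using B G x2 by simp
  hence "G *\<^sub>v y1 + (- (G * B)) *\<^sub>v x2 = (G * A) *\<^sub>v x1 \<longleftrightarrow>
    G *\<^sub>v (A *\<^sub>v x1) + G *\<^sub>v (B *\<^sub>v x2) = G *\<^sub>v y1"
    using A G x1 vec_add_eq_iff_add_uminus[OF car(4,5,3)] by simp
  moreover have "(A * G) *\<^sub>v y1 = A *\<^sub>v (G *\<^sub>v y1)" using A G y1 by simp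
  ultimately show ?thesis using first second by auto
qed

theorem lemma2p2:
  fixes n :: nat and A B C D M P Q :: "complex mat"
  assumes "A \<in> carrier_mat n n" and "B \<in> carrier_mat n n"
    and "C \<in> carrier_mat n n" and "D \<in> carrier_mat n n"
    and "M = four_block_mat A B C D"
    and "has_group_inverse A" and "has_group_inverse D"
    and "P = pppt A B C D" and "Q = cpppt A B C D"
  shows "(vec_space.col_space n B \<subseteq> vec_space.col_space n A \<and>
          vec_space.col_space n (mat_adjoint C) \<subseteq> vec_space.col_space n (mat_adjoint A) \<longrightarrow>
          (\<forall>x1 \<in> carrier_vec n. \<forall>x2 \<in> carrier_vec n. \<forall>y1 \<in> carrier_vec n. \<forall>y2 \<in> carrier_vec n.
             M *\<^sub>v (x1 @\<^sub>v x2) = ((A * A\<^sup>#) *\<^sub>v y1) @\<^sub>v y2 \<longleftrightarrow>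
             P *\<^sub>v (y1 @\<^sub>v x2) = ((A\<^sup># * A) *\<^sub>v x1) @\<^sub>v y2)) \<and>
         (vec_space.col_space n C \<subseteq> vec_space.col_space n D \<and>
          vec_space.col_space n (mat_adjoint B) \<subseteq> vec_space.col_space n (mat_adjoint D) \<longrightarrow>
          (\<forall>x1 \<in> carrier_vec n. \<forall>x2 \<in> carrier_vec n. \<forall>y1 \<in> carrier_vec n. \<forall>y2 \<in> carrier_vec n.
             M *\<^sub>v (x1 @\<^sub>v x2) = y1 @\<^sub>v ((D * D\<^sup>#) *\<^sub>v y2) \<longleftrightarrow>
             Q *\<^sub>v (x1 @\<^sub>v y2) = y1 @\<^sub>v ((D\<^sup># * D) *\<^sub>v x2)))"
proof -
  note A = assms(1) and B = assms(2) and C = assms(3) and D = assms(4) and M = assms(5)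
    and P = assms(8) and Q = assms(9)
  \<comment> \<open>The symbol \<open>A\<^sup>#\<close> is a definite description, so its equations
    become available only through the existence of a group inverse.\<close>
  have A': "A\<^sup># \<in> carrier_mat n n" "A * A\<^sup># * A = A" "A\<^sup># * A * A\<^sup># = A\<^sup>#"
    using is_group_inverse_group_inverse[OF assms(6)] A by (auto simp: is_group_inverse_def)
  have D': "D\<^sup># \<in> carrier_mat n n" "D * D\<^sup># * D = D" "D\<^sup># * D * D\<^sup># = D\<^sup>#"
    using is_group_inverse_group_inverse[OF assms(7)] D by (auto simp: is_group_inverse_def)
  have i: "M *\<^sub>v (x1 @\<^sub>v x2) = ((A * A\<^sup>#) *\<^sub>v y1) @\<^sub>v y2 \<longleftrightarrow>
      P *\<^sub>v (y1 @\<^sub>v x2) = ((A\<^sup># * A) *\<^sub>v x1) @\<^sub>v y2"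
    if range: "vec_space.col_space n B \<subseteq> vec_space.col_space n A"
      "vec_space.col_space n (mat_adjoint C) \<subseteq> vec_space.col_space n (mat_adjoint A)"
      and x: "x1 \<in> carrier_vec n" "x2 \<in> carrier_vec n"
      and y: "y1 \<in> carrier_vec n" "y2 \<in> carrier_vec n" for x1 x2 y1 y2
  proof -
    have Mv: "M *\<^sub>v (x1 @\<^sub>v x2) = (A *\<^sub>v x1 + B *\<^sub>v x2) @\<^sub>v (C *\<^sub>v x1 + D *\<^sub>v x2)"
      unfolding M by (rule four_block_mat_mult_vec[OF A B C D x])
    have Pv: "P *\<^sub>v (y1 @\<^sub>v x2) = (A\<^sup># *\<^sub>v y1 + (- (A\<^sup># * B)) *\<^sub>v x2) @\<^sub>v
        ((C * A\<^sup>#) *\<^sub>v y1 + (D - C * A\<^sup># * B) *\<^sub>v x2)"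
      unfolding P pppt_def
      by (rule four_block_mat_mult_vec[of _ n n _ n _ n]) (use A' B C D x y in auto)
    \<comment> \<open>Equality of concatenated vectors splits into the two block equations once the
      first halves are known to have the same length.\<close>
    have car: "A *\<^sub>v x1 + B *\<^sub>v x2 \<in> carrier_vec n" "(A * A\<^sup>#) *\<^sub>v y1 \<in> carrier_vec n"
      "A\<^sup># *\<^sub>v y1 + (- (A\<^sup># * B)) *\<^sub>v x2 \<in> carrier_vec n" "(A\<^sup># * A) *\<^sub>v x1 \<in> carrier_vec n"
      using A A' B x y by auto
    show ?thesis
      unfolding Mv Pv append_vec_eq[OF car(1,2)] append_vec_eq[OF car(3,4)]
      by (rule principal_pivot_iff[OF A B C D A'
            inner_inverse_absorb_left[OF A A'(1) B A'(2) range(1)]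
            inner_inverse_absorb_right[OF A A'(1) C A'(2) range(2)] x y])
  qed
  have ii: "M *\<^sub>v (x1 @\<^sub>v x2) = y1 @\<^sub>v ((D * D\<^sup>#) *\<^sub>v y2) \<longleftrightarrow>
      Q *\<^sub>v (x1 @\<^sub>v y2) = y1 @\<^sub>v ((D\<^sup># * D) *\<^sub>v x2)"
    if range: "vec_space.col_space n C \<subseteq> vec_space.col_space n D"
      "vec_space.col_space n (mat_adjoint B) \<subseteq> vec_space.col_space n (mat_adjoint D)"
      and x: "x1 \<in> carrier_vec n" "x2 \<in> carrier_vec n"
      and y: "y1 \<in> carrier_vec n" "y2 \<in> carrier_vec n" for x1 x2 y1 y2
  proof -
    \<comment> \<open>The summands are swapped to put the \<open>x2\<close> term first, as needed
      for the instance with \<open>D\<close>, \<open>C\<close>, \<open>B\<close>, \<open>A\<close>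
      in place of \<open>A\<close>, \<open>B\<close>, \<open>C\<close>, \<open>D\<close>.\<close>
    have Mv: "M *\<^sub>v (x1 @\<^sub>v x2) = (B *\<^sub>v x2 + A *\<^sub>v x1) @\<^sub>v (D *\<^sub>v x2 + C *\<^sub>v x1)"
      unfolding M four_block_mat_mult_vec[OF A B C D x]
      using A B C D x by (simp add: comm_add_vec[of _ n])
    have Qv0: "Q *\<^sub>v (x1 @\<^sub>v y2) = ((A - B * D\<^sup># * C) *\<^sub>v x1 + (B * D\<^sup>#) *\<^sub>v y2) @\<^sub>v
        ((- (D\<^sup># * C)) *\<^sub>v x1 + D\<^sup># *\<^sub>v y2)"
      unfolding Q cpppt_def
      by (rule four_block_mat_mult_vec[of _ n n _ n _ n]) (use A B C D' x y in auto)
    have "A - B * D\<^sup># * C \<in> carrier_mat n n" "- (D\<^sup># * C) \<in> carrier_mat n n"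
      "B * D\<^sup># \<in> carrier_mat n n"
      using A B C D' by auto
    hence carQ: "(A - B * D\<^sup># * C) *\<^sub>v x1 \<in> carrier_vec n"
      "(- (D\<^sup># * C)) *\<^sub>v x1 \<in> carrier_vec n" "(B * D\<^sup>#) *\<^sub>v y2 \<in> carrier_vec n"
      "D\<^sup># *\<^sub>v y2 \<in> carrier_vec n"
      using D' x y by (blast intro: mult_mat_vec_carrier)+
    have Qv: "Q *\<^sub>v (x1 @\<^sub>v y2) = ((B * D\<^sup>#) *\<^sub>v y2 + (A - B * D\<^sup># * C) *\<^sub>v x1) @\<^sub>v
        (D\<^sup># *\<^sub>v y2 + (- (D\<^sup># * C)) *\<^sub>v x1)"
      unfolding Qv0 comm_add_vec[OF carQ(1,3)] comm_add_vec[OF carQ(2,4)] ..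
    have car: "B *\<^sub>v x2 + A *\<^sub>v x1 \<in> carrier_vec n"
      "(B * D\<^sup>#) *\<^sub>v y2 + (A - B * D\<^sup># * C) *\<^sub>v x1 \<in> carrier_vec n"
      using A B x carQ by auto
    show ?thesis
      unfolding Mv Qv append_vec_eq[OF car(1) y(1)] append_vec_eq[OF car(2) y(1)]
      \<comment> \<open>This instance lists the lower block equation before the upper one; only the
        order of the conjuncts remains to be exchanged.\<close>
      using principal_pivot_iff[OF D C B A D'
            inner_inverse_absorb_left[OF D D'(1) C D'(2) range(1)]
            inner_inverse_absorb_right[OF D D'(1) B D'(2) range(2)] x(2,1) y(2,1)]
      by blast
  qed
  show ?thesis using i ii by blast
qed

end
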